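(* For all integers $n\ge0$, $$\xi(23n+18)\equiv\xi(23n+19)\equiv\xi(23n+20)\equiv\xi(23n+21)\equiv\xi(23n+22)\equiv0\pmod{23}.$$
   Context: The Fishburn numbers $\xi(n)\in\mathbb{Z}$ ($n\ge 0$) are defined by the formal power series identity $$\sum_{n=0}^\infty \xi(n)q^n=F(1-q)=\sum_{n=0}^\infty\prod_{i=1}^n\left(1-(1-q)^i\right),\qquad F(q)=\sum_{n=0}^\infty\prod_{i=1}^n(1-q^i),$$ which is well defined in $\mathbb{Z}[[q]]$ because the $n$-th summand of $F(1-q)$ is divisible by $q^n$. *)

theory Defs
  imports "HOL-Computational_Algebra.Formal_Power_Series" "HOL-Number_Theory.Cong"
begin

text \<open>
  The infinite sum is taken in the library's \<open>X\<close>-adic topology on \<open>int fps\<close>, where convergence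
  means that every coefficient is eventually constant (\<open>tendsto_fps_iff\<close>). The argument \<open>q\<close> is
  itself a power series: the sum need not converge for arbitrary \<open>q\<close>, but it does for
  \<open>q = 1 - fps_X\<close> (lemma \<open>fishburn_sums\<close> below).
\<close>

definition fishburn_F :: "int fps \<Rightarrow> int fps" where
  "fishburn_F q = (\<Sum>n. \<Prod>i=1..n. (1 - q ^ i))"

definition fishburn :: "nat \<Rightarrow> int" where
  "fishburn n = fps_nth (fishburn_F (1 - fps_X)) n"

lemma fishburn_summand_dvd:
  "(fps_X :: int fps) ^ n dvd (\<Prod>i=1..n. (1 - (1 - fps_X) ^ i))"
proof -
  have "(fps_X :: int fps) dvd 1 - (1 - fps_X) ^ i" for i
  proof -
    have "1 - (1 - fps_X) ^ i = (1 - (1 - fps_X)) * (\<Sum>j<i. (1 - fps_X :: int fps) ^ j)"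
      by (rule one_diff_power_eq)
    then have "1 - (1 - fps_X) ^ i = fps_X * (\<Sum>j<i. (1 - fps_X :: int fps) ^ j)"
      by (simp only: diff_diff_eq2 add_diff_cancel_left')
    then show ?thesis by (rule dvdI)
  qed
  then have "(\<Prod>i=1..n. fps_X :: int fps) dvd (\<Prod>i=1..n. (1 - (1 - fps_X) ^ i))"
    by (intro prod_dvd_prod) auto
  then show ?thesis by simp
qed

lemma fishburn_summand_nth_eq_0:
  assumes "k < n"
  shows "fps_nth (\<Prod>i=1..n. (1 - (1 - fps_X :: int fps) ^ i)) k = 0"
proof -
  obtain g where "(\<Prod>i=1..n. (1 - (1 - fps_X :: int fps) ^ i)) = fps_X ^ n * g"
    using fishburn_summand_dvd[of n] by (elim dvdE)
  then show ?thesis using assms by (simp only: fps_X_power_mult_nth if_True)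
qed

lemma fishburn_sums:
  "(\<lambda>n. \<Prod>i=1..n. (1 - (1 - fps_X :: int fps) ^ i)) sums
     Abs_fps (\<lambda>k. \<Sum>n\<le>k. fps_nth (\<Prod>i=1..n. (1 - (1 - fps_X) ^ i)) k)"
  unfolding sums_def
proof (rule tendsto_fpsI)
  fix k
  show "\<forall>\<^sub>F N in sequentially.
          fps_nth (\<Sum>n<N. \<Prod>i=1..n. (1 - (1 - fps_X :: int fps) ^ i)) k =
          fps_nth (Abs_fps (\<lambda>k. \<Sum>n\<le>k. fps_nth (\<Prod>i=1..n. (1 - (1 - fps_X) ^ i)) k)) k"
    using eventually_gt_at_top[of k]
  proof eventually_elim
    case (elim N)
    then show ?case
      unfolding fps_sum_nth fps_nth_Abs_fps
      by (intro sum.mono_neutral_right ballI fishburn_summand_nth_eq_0) auto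
  qed
qed

lemma fishburn_eq_sum:
  "fishburn k = (\<Sum>n\<le>k. fps_nth (\<Prod>i=1..n. (1 - (1 - fps_X :: int fps) ^ i)) k)"
  unfolding fishburn_def fishburn_F_def sums_unique[OF fishburn_sums, symmetric]
  by (rule fps_nth_Abs_fps)

end

theory Submission
  imports Defs "HOL-Computational_Algebra.Polynomial"
begin

text \<open>
  Write \<open>x = 1 - q\<close>, and let \<open>\<chi>\<close> be the even character modulo 12 with \<open>\<chi>(1) = \<chi>(11) = 1\<close> and
  \<open>\<chi>(5) = \<chi>(7) = - 1\<close>. Zagier's ``strange identity'' says, in a regularised sense, that
  \<open>F(x)\<close> is \<open>-1/2\<close> times the divergent sum of \<open>\<chi>(n) n x^((n^2 - 1)/24)\<close> over \<open>n > 0\<close>. If it is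
  granted, the congruences are visible: by Lucas' theorem, for a prime \<open>p\<close>, the coefficient of \<open>q^m\<close> in
  \<open>(1 - q)^N\<close> vanishes modulo \<open>p\<close> unless \<open>m mod p \<le> N mod p\<close>. For \<open>24 N + 1 = n^2\<close>
  and \<open>p = 23\<close> the residue of \<open>N\<close> is one less than a square. The residues 19 to 23 contain no
  square prime to 23, so \<open>N mod 23 \<ge> 18\<close> forces \<open>N mod 23 = 22\<close> and hence \<open>23 dvd n\<close>; in
  that case the factor \<open>n\<close> makes the term vanish.

  The regularisation is replaced by periodicity modulo \<open>p\<close>. The series
  \<open>S(z) = \<Sum>n. z^n (1 - z) (1 - z x) \<cdots> (1 - z x^n)\<close> satisfies
  \<open>S(z) = 1 - x z^2 - x^2 z^3 S(x z)\<close> (\<open>kz_sum_functional_equation\<close>, a telescoping sum).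
  It vanishes at \<open>z = 1\<close>, where its derivative is \<open>- F(x)\<close>. For \<open>K = p^a\<close> the series
  \<open>x^K = 1 - q^K\<close> is \<open>1\<close> modulo \<open>p\<close> up to high order in \<open>q\<close>, so that \<open>K\<close> applications of the
  functional equation lead from \<open>S(z)\<close> back to itself, with sign \<open>- 1\<close> because \<open>K\<close> is odd.
  Differentiating at \<open>z = 1\<close> turns this into a finite strange identity
  (\<open>fishburn_sum_eq_pentagonal_sum\<close>): modulo \<open>p\<close> and high powers of \<open>q\<close>,
  \<open>- 4 F(x)\<close> is the sum of \<open>\<chi>(n) n x^((n^2 - 1)/24)\<close> over \<open>0 < n < 6 K\<close>.

  The derivative is taken by evaluating at dual numbers \<open>z = x^k (1 + e)\<close>: these are polynomials
  in \<open>e\<close> of which only the coefficients of \<open>1\<close> and \<open>e\<close> matter.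
\<close>

section \<open>The functional equation\<close>

text \<open>
  Partial sums suffice: after the specialisation \<open>x = 1 - q\<close>, \<open>z = x^k (1 + e)\<close> the \<open>n\<close>-th term
  belongs to the ideal \<open>(q, e) ^ (n + 1)\<close>.
\<close>

definition kz_sum :: "'a::comm_ring_1 \<Rightarrow> nat \<Rightarrow> 'a \<Rightarrow> 'a" where
  "kz_sum x N z = (\<Sum>n<N. z ^ n * (\<Prod>i\<le>n. 1 - z * x ^ i))"

text \<open>
  With \<open>h n = (1 - z x) \<cdots> (1 - z x^n)\<close> the \<open>n\<close>-th terms of the two sums add up to
  \<open>U n - U (n + 1)\<close>, where \<open>U n = z^n * h n * (1 - x^(n + 1) * z^2)\<close>. The right-hand side is
  therefore \<open>U 0 - U N\<close>.
\<close>

lemma kz_sum_functional_equation: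
  "kz_sum x N z + x\<^sup>2 * z ^ 3 * kz_sum x N (x * z) =
     1 - x * z\<^sup>2 - z ^ N * (\<Prod>i=1..N. 1 - z * x ^ i) * (1 - x ^ (N + 1) * z\<^sup>2)"
proof (induction N)
  case 0
  then show ?case by (simp add: kz_sum_def)
next
  case (Suc N)
  define h where "h = (\<Prod>i=1..N. 1 - z * x ^ i)"
  have h_Suc: "(\<Prod>i=1..Suc N. 1 - z * x ^ i) = h * (1 - z * x ^ (N + 1))"
    by (simp add: h_def)
  have prod_z: "(\<Prod>i\<le>N. 1 - z * x ^ i) = (1 - z) * h"
    by (simp add: h_def atLeast0AtMost[symmetric] prod.atLeast_Suc_atMost)
  have prod_xz: "(\<Prod>i\<le>N. 1 - x * z * x ^ i) = h * (1 - z * x ^ (N + 1))"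
    unfolding h_Suc[symmetric]
    by (simp only: One_nat_def prod.atLeast_Suc_atMost_Suc_shift) (simp add: atLeast0AtMost mult_ac)
  have "kz_sum x (Suc N) z + x\<^sup>2 * z ^ 3 * kz_sum x (Suc N) (x * z) =
      (kz_sum x N z + x\<^sup>2 * z ^ 3 * kz_sum x N (x * z)) +
      (z ^ N * ((1 - z) * h) + x\<^sup>2 * z ^ 3 * ((x * z) ^ N * (h * (1 - z * x ^ (N + 1)))))"
    unfolding kz_sum_def sum.lessThan_Suc prod_z prod_xz
    by (simp only: distrib_left add_ac)
  also have "\<dots> = 1 - x * z\<^sup>2 -
      z ^ Suc N * (h * (1 - z * x ^ (N + 1))) * (1 - x ^ (Suc N + 1) * z\<^sup>2)"
    unfolding Suc.IH h_def[symmetric] power_mult_distrib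
    by (simp add: algebra_simps power2_eq_square power3_eq_cube)
  finally show ?case by (simp only: h_Suc)
qed

section \<open>Powers of \<open>1 - q\<close> modulo a prime\<close>

lemma of_nat_dvd_of_natI: "m dvd n \<Longrightarrow> (of_nat m :: 'a::comm_semiring_1) dvd of_nat n"
  by auto

lemma prime_dvd_freshman:
  fixes a b :: "'a::comm_ring_1"
  assumes "prime p"
  shows "of_nat p dvd (a + b) ^ p - (a ^ p + b ^ p)"
proof -
  have p: "p > 0" using assms prime_gt_0_nat by blast
  have split: "{..p} = insert 0 (insert p {0<..<p})" by auto
  have "(a + b) ^ p - (a ^ p + b ^ p) =
      (\<Sum>k\<in>{0<..<p}. of_nat (p choose k) * a ^ k * b ^ (p - k))"
    unfolding binomial_ring split using p by simp
  also have "of_nat p dvd \<dots>"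
    by (intro dvd_sum dvd_mult2 of_nat_dvd_of_natI) (use assms in \<open>auto intro!: dvd_choose_prime\<close>)
  finally show ?thesis .
qed

lemma dvd_diff_power:
  fixes a b c :: "'a::comm_ring_1"
  assumes "c dvd a - b"
  shows "c dvd a ^ n - b ^ n"
  using assms power_diff_sumr2[of a n b] by (metis dvd_mult2)

lemma one_minus_fps_X_prime_power:
  assumes p: "prime p" "odd p"
  shows "of_nat p dvd (1 - fps_X :: int fps) ^ (p ^ a) - (1 - fps_X ^ (p ^ a))"
proof (induction a)
  case 0
  then show ?case by simp
next
  case (Suc a)
  let ?u = "1 - fps_X ^ (p ^ a) :: int fps"
  have "of_nat p dvd ((1 - fps_X :: int fps) ^ (p ^ a)) ^ p - ?u ^ p"
    by (rule dvd_diff_power[OF Suc.IH])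
  moreover have "of_nat p dvd ?u ^ p - (1 - fps_X ^ (p ^ Suc a))"
    using prime_dvd_freshman[OF p(1), of 1 "- (fps_X ^ (p ^ a)) :: int fps"] p(2)
    by (simp add: power_minus_odd power_mult[symmetric] mult.commute)
  ultimately have "of_nat p dvd (((1 - fps_X :: int fps) ^ (p ^ a)) ^ p - ?u ^ p)
      + (?u ^ p - (1 - fps_X ^ (p ^ Suc a)))"
    by (rule dvd_add)
  moreover have "((1 - fps_X :: int fps) ^ (p ^ a)) ^ p = (1 - fps_X) ^ (p ^ Suc a)"
    by (simp add: power_mult[symmetric] mult.commute)
  ultimately show ?case
    by (simp only: add_diff_eq diff_add_cancel)
qed

lemma dvd_fps_nth:
  assumes "of_nat p dvd (f :: int fps)"
  shows "int p dvd fps_nth f i"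
  using assms by (auto elim!: dvdE simp: fps_of_nat[symmetric])

text \<open>
  The part of Lucas' theorem that is needed: modulo \<open>p\<close>, \<open>(1 - q)^N\<close> is a polynomial of degree
  \<open>N mod p\<close> times a power of \<open>1 - q^p\<close>, and multiplication by \<open>1 - q^p\<close> preserves the set of
  residues modulo \<open>p\<close> of the exponents that occur.
\<close>

lemma dvd_nth_one_minus_fps_X_power:
  assumes p: "prime p" "odd p" and N: "N mod p < j" and m: "j \<le> m mod p"
  shows "int p dvd fps_nth ((1 - fps_X :: int fps) ^ N) m"
proof -
  let ?x = "1 - fps_X :: int fps"
  have deg: "fps_nth (?x ^ c) i = 0" if "c < i" for c i
    using that by (induction c arbitrary: i) (auto simp: algebra_simps)
  have "int p dvd fps_nth (?x ^ (b * p) * ?x ^ (N mod p)) m" for b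
    using m
  proof (induction b arbitrary: m)
    case 0
    then have "N mod p < m" using N mod_less_eq_dividend[of m p] by linarith
    then show ?case by (simp add: deg)
  next
    case (Suc b)
    let ?f = "?x ^ (b * p) * ?x ^ (N mod p)"
    obtain g where "?x ^ p - (1 - fps_X ^ p) = of_nat p * g"
      using one_minus_fps_X_prime_power[OF p, of 1] by (auto elim: dvdE)
    then have g: "?x ^ p = (1 - fps_X ^ p) + of_nat p * g"
      by (simp add: diff_eq_eq add.commute)
    have "?x ^ (Suc b * p) * ?x ^ (N mod p) = ?x ^ p * ?f"
      by (simp add: power_add mult_ac)
    also have "\<dots> = ?f - fps_X ^ p * ?f + of_nat p * (g * ?f)"
      unfolding g by (simp add: algebra_simps)
    finally have "fps_nth (?x ^ (Suc b * p) * ?x ^ (N mod p)) m =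
        fps_nth ?f m - fps_nth (fps_X ^ p * ?f) m + fps_nth (of_nat p * (g * ?f)) m"
      by simp
    moreover have "int p dvd fps_nth ?f m" by (rule Suc.IH[OF Suc.prems])
    moreover have "int p dvd fps_nth (fps_X ^ p * ?f) m"
      using Suc.IH[of "m - p"] Suc.prems by (auto simp: fps_X_power_mult_nth le_mod_geq)
    moreover have "int p dvd fps_nth (of_nat p * (g * ?f)) m"
      by (rule dvd_fps_nth) simp
    ultimately show ?case by (metis dvd_add dvd_diff)
  qed
  from this[of "N div p"] show ?thesis
    by (simp add: power_add[symmetric])
qed

section \<open>The derivative of the functional equation at powers of \<open>x\<close>\<close>

definition dual_point :: "'a::comm_ring_1 \<Rightarrow> nat \<Rightarrow> 'a poly" where
  "dual_point x k = smult (x ^ k) [:1, 1:]"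

text \<open>
  At \<open>z = x^k (1 + e)\<close> the coefficient of \<open>e\<close> is the value of the derivation \<open>z d/dz\<close> at \<open>x^k\<close>.
  The combination below gives \<open>(1 + e)^r\<close> the weight \<open>6 k + 1 + 2 r\<close>. The factor
  \<open>z^3\<close> in front of \<open>S(x z)\<close> shifts this weight by 6, which is why one application of the
  functional equation passes from level \<open>k\<close> to level \<open>k + 1\<close>; the two terms \<open>1\<close> and \<open>x z^2\<close>
  receive the weights \<open>6 k + 1\<close> and \<open>6 k + 5\<close>, the numbers \<open>n\<close> prime to 6.
\<close>

definition level_weight :: "nat \<Rightarrow> 'a::comm_ring_1 poly \<Rightarrow> 'a" where
  "level_weight k f = 2 * coeff f 1 + of_nat (6 * k + 1) * coeff f 0"

lemma coeff_1_mult: "coeff (f * g) 1 = coeff f 0 * coeff g 1 + coeff f 1 * coeff g 0"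
  by (simp add: coeff_mult)

lemma coeff_dual_power:
  "coeff ([:1, 1:] ^ r) 0 = (1::'a::comm_ring_1)"
  "coeff ([:1, 1:] ^ r) 1 = (of_nat r :: 'a)"
proof (induction r)
  case 0
  { case 1 then show ?case by simp }
  { case 2 then show ?case by simp }
next
  case (Suc r)
  { case 1 then show ?case by (simp add: coeff_mult Suc.IH) }
  { case 2 then show ?case unfolding power_Suc coeff_1_mult Suc.IH by simp }
qed

lemma level_weight_diff: "level_weight k (f - g) = level_weight k f - level_weight k g"
  by (simp add: level_weight_def algebra_simps)

definition boundary :: "'a::comm_ring_1 \<Rightarrow> nat \<Rightarrow> 'a \<Rightarrow> 'a" where
  "boundary x N z = z ^ N * (\<Prod>i=1..N. 1 - z * x ^ i) * (1 - x ^ (N + 1) * z\<^sup>2)"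

lemma level_weight_kz_sum_step:
  fixes x :: "'a::comm_ring_1" and N :: nat
  defines "W \<equiv> \<lambda>k. level_weight k (kz_sum [:x:] N (dual_point x k))"
  shows "W k = of_nat (6 * k + 1) - of_nat (6 * k + 5) * x ^ (2 * k + 1)
    - level_weight k (boundary [:x:] N (dual_point x k)) - x ^ (3 * k + 2) * W (Suc k)"
proof -
  let ?z = "dual_point x k" and ?e = "[:1, 1:] :: 'a poly"
  let ?f = "kz_sum [:x:] N (dual_point x (Suc k))"
  have z_k: "?z ^ r = smult (x ^ (r * k)) (?e ^ r)" for r
    unfolding dual_point_def smult_power power_mult[symmetric] by (simp only: mult.commute)
  have "[:x:] * ?z = dual_point x (Suc k)"
    by (simp add: dual_point_def)
  then have "kz_sum [:x:] N ?z + [:x:]\<^sup>2 * ?z ^ 3 * ?f =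
      1 - [:x:] * ?z\<^sup>2 - boundary [:x:] N ?z"
    using kz_sum_functional_equation[of "[:x:]" N ?z] by (simp add: boundary_def)
  moreover have "[:x:]\<^sup>2 * ?z ^ 3 * ?f = smult (x ^ (3 * k + 2)) (?e ^ 3 * ?f)"
    unfolding z_k by (simp add: power2_eq_square power_mult[symmetric] power_add mult_ac)
  moreover have "[:x:] * ?z\<^sup>2 = smult (x ^ (2 * k + 1)) (?e ^ 2)"
    unfolding z_k by (simp add: power_mult[symmetric] power_add mult_ac)
  ultimately have "kz_sum [:x:] N ?z = 1 - smult (x ^ (2 * k + 1)) (?e ^ 2)
      - boundary [:x:] N ?z - smult (x ^ (3 * k + 2)) (?e ^ 3 * ?f)"
    by (simp add: algebra_simps)
  then have "W k = level_weight k (1 :: 'a poly) - level_weight k (smult (x ^ (2 * k + 1)) (?e ^ 2))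
      - level_weight k (boundary [:x:] N ?z) - level_weight k (smult (x ^ (3 * k + 2)) (?e ^ 3 * ?f))"
    unfolding W_def by (simp only: level_weight_diff)
  moreover have "level_weight k (1 :: 'a poly) = of_nat (6 * k + 1)"
    by (simp add: level_weight_def)
  moreover have "level_weight k (smult (x ^ (2 * k + 1)) (?e ^ 2)) = of_nat (6 * k + 5) * x ^ (2 * k + 1)"
    unfolding level_weight_def coeff_smult coeff_dual_power by (simp add: algebra_simps)
  moreover have "level_weight k (smult (x ^ (3 * k + 2)) (?e ^ 3 * ?f)) = x ^ (3 * k + 2) * W (Suc k)"
    unfolding W_def level_weight_def coeff_smult coeff_1_mult coeff_mult_0 coeff_dual_power
    by (simp add: algebra_simps)
  ultimately show ?thesis by simp
qed

text \<open>
  This is \<open>(n^2 - 1)/24\<close> for \<open>n = 6 k + 1\<close>; the value for \<open>n = 6 k + 5\<close> is larger by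
  \<open>2 k + 1\<close>.
\<close>

definition pentagonal :: "nat \<Rightarrow> nat" where
  "pentagonal k = k * (3 * k + 1) div 2"

lemma two_pentagonal: "2 * pentagonal k = k * (3 * k + 1)"
  unfolding pentagonal_def by simp

lemma pentagonal_Suc: "pentagonal (Suc k) = pentagonal k + (3 * k + 2)"
  using two_pentagonal[of k] two_pentagonal[of "Suc k"] by (simp add: algebra_simps)

lemma level_weight_kz_sum_iterate:
  fixes x :: "'a::comm_ring_1" and N :: nat
  defines "W \<equiv> \<lambda>k. level_weight k (kz_sum [:x:] N (dual_point x k))"
  shows "W 0 = (\<Sum>k<K. (-1) ^ k * x ^ pentagonal k *
      (of_nat (6 * k + 1) - of_nat (6 * k + 5) * x ^ (2 * k + 1)
        - level_weight k (boundary [:x:] N (dual_point x k)))) + (-1) ^ K * x ^ pentagonal K * W K"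
proof (induction K)
  case 0
  then show ?case by (simp add: pentagonal_def)
next
  case (Suc K)
  have step: "W K = of_nat (6 * K + 1) - of_nat (6 * K + 5) * x ^ (2 * K + 1)
      - level_weight K (boundary [:x:] N (dual_point x K)) - x ^ (3 * K + 2) * W (Suc K)"
    unfolding W_def by (rule level_weight_kz_sum_step)
  have "(-1) ^ K * x ^ pentagonal K * W K =
      (-1) ^ K * x ^ pentagonal K * (of_nat (6 * K + 1) - of_nat (6 * K + 5) * x ^ (2 * K + 1)
        - level_weight K (boundary [:x:] N (dual_point x K))) + (-1) ^ Suc K * x ^ pentagonal (Suc K) * W (Suc K)"
    unfolding step pentagonal_Suc power_add by (simp add: right_diff_distrib mult_ac)
  then show ?case
    using Suc.IH by simp
qed

text \<open>
  Every term of the sum has the factor \<open>1 - z = - e\<close>, so the remaining factors only contribute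
  their values at \<open>z = 1\<close>.
\<close>

lemma level_weight_kz_sum_0:
  fixes x :: "'a::comm_ring_1"
  shows "level_weight 0 (kz_sum [:x:] N [:1, 1:]) = - 2 * (\<Sum>n<N. \<Prod>i=1..n. 1 - x ^ i)"
proof -
  let ?e = "[:1, 1:] :: 'a poly"
  have c0: "coeff (\<Prod>i\<in>A. 1 - ?e * [:x:] ^ i) 0 = (\<Prod>i\<in>A. 1 - x ^ i)" for A
    by (induction A rule: infinite_finite_induct) (auto simp: coeff_mult poly_const_pow)
  have "?e ^ n * (\<Prod>i\<le>n. 1 - ?e * [:x:] ^ i) =
      (1 - ?e) * (?e ^ n * (\<Prod>i=1..n. 1 - ?e * [:x:] ^ i))" for n
    unfolding atLeast0AtMost[symmetric] prod.atLeast_Suc_atMost[OF le0] One_nat_def power_0 mult_1_right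
    by (rule mult.left_commute)
  then have "kz_sum [:x:] N ?e =
      (1 - ?e) * (\<Sum>n<N. ?e ^ n * (\<Prod>i=1..n. 1 - ?e * [:x:] ^ i))"
    unfolding kz_sum_def by (simp only: sum_distrib_left)
  then show ?thesis
    unfolding level_weight_def
    by (simp only: coeff_1_mult coeff_mult_0 coeff_sum c0 coeff_dual_power) simp
qed

section \<open>Congruences modulo \<open>p\<close>, \<open>q^L\<close> and \<open>e^2\<close>\<close>

text \<open>
  The elements of the ideal \<open>(p, q^L)\<close>, written by coefficients. The next predicate is its
  analogue \<open>(p, q^L, e^2)\<close> for the ring with \<open>e\<close> adjoined.
\<close>

definition negligible :: "nat \<Rightarrow> nat \<Rightarrow> int fps \<Rightarrow> bool" where
  "negligible p L f \<longleftrightarrow> (\<forall>i<L. int p dvd fps_nth f i)"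

lemma negligible_0: "negligible p L 0"
  by (simp add: negligible_def)

lemma negligible_add: "negligible p L f \<Longrightarrow> negligible p L g \<Longrightarrow> negligible p L (f + g)"
  by (simp add: negligible_def)

lemma negligible_diff: "negligible p L f \<Longrightarrow> negligible p L g \<Longrightarrow> negligible p L (f - g)"
  by (simp add: negligible_def)

lemma negligible_mult: "negligible p L g \<Longrightarrow> negligible p L (f * g)"
  by (auto simp: negligible_def fps_mult_nth intro!: dvd_sum)

lemma negligible_sum: "(\<And>i. i \<in> A \<Longrightarrow> negligible p L (f i)) \<Longrightarrow> negligible p L (sum f A)"
  by (induction A rule: infinite_finite_induct) (auto intro: negligible_0 negligible_add)

definition dual_negligible :: "nat \<Rightarrow> nat \<Rightarrow> int fps poly \<Rightarrow> bool" where
  "dual_negligible p L f \<longleftrightarrow> negligible p L (coeff f 0) \<and> negligible p L (coeff f 1)"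

lemma dual_negligible_0: "dual_negligible p L 0"
  by (simp add: dual_negligible_def negligible_0)

lemma dual_negligible_add: "dual_negligible p L f \<Longrightarrow> dual_negligible p L g \<Longrightarrow> dual_negligible p L (f + g)"
  by (simp add: dual_negligible_def negligible_add)

lemma dual_negligible_mult: "dual_negligible p L g \<Longrightarrow> dual_negligible p L (f * g)"
  unfolding dual_negligible_def coeff_1_mult coeff_mult_0 by (blast intro: negligible_mult negligible_add)

lemma dual_negligible_level_weight: "dual_negligible p L f \<Longrightarrow> negligible p L (level_weight k f)"
  unfolding dual_negligible_def level_weight_def by (blast intro: negligible_mult negligible_add)

lemma dual_negligible_mult_diff:
  assumes "dual_negligible p L (f - f')" "dual_negligible p L (g - g')"
  shows "dual_negligible p L (f * g - f' * g')"
proof -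
  have "f * g - f' * g' = f * (g - g') + g' * (f - f')" by (simp add: algebra_simps)
  then show ?thesis using assms by (simp add: dual_negligible_add dual_negligible_mult)
qed

lemma dual_negligible_power_diff:
  "dual_negligible p L (f - f') \<Longrightarrow> dual_negligible p L (f ^ n - f' ^ n)"
  by (induction n) (auto simp: dual_negligible_0 intro: dual_negligible_mult_diff)

lemma dual_negligible_prod_diff:
  "(\<And>i. i \<in> A \<Longrightarrow> dual_negligible p L (f i - f' i)) \<Longrightarrow> dual_negligible p L (prod f A - prod f' A)"
  by (induction A rule: infinite_finite_induct) (auto simp: dual_negligible_0 intro: dual_negligible_mult_diff)

lemma dual_negligible_sum:
  "(\<And>i. i \<in> A \<Longrightarrow> dual_negligible p L (f i)) \<Longrightarrow> dual_negligible p L (sum f A)"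
  by (induction A rule: infinite_finite_induct) (auto intro: dual_negligible_0 dual_negligible_add)

lemma dual_negligible_kz_sum_diff:
  assumes "dual_negligible p L (z - z')"
  shows "dual_negligible p L (kz_sum x N z - kz_sum x N z')"
proof -
  have "dual_negligible p L ((1 - z * x ^ i) - (1 - z' * x ^ i))" for i
    using dual_negligible_mult[OF assms, of "- (x ^ i)"] by (simp add: algebra_simps)
  then show ?thesis
    unfolding kz_sum_def sum_subtractf[symmetric]
    by (intro dual_negligible_sum dual_negligible_mult_diff dual_negligible_power_diff dual_negligible_prod_diff assms)
qed

text \<open>
  The \<open>M\<close>-th power of the ideal \<open>(q, e)\<close>. Each factor \<open>1 - z x^i\<close> of the boundary term lies in
  this ideal, so a product of \<open>L + 1\<close> of them is still divisible by \<open>q^L\<close> in the coefficient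
  of \<open>e\<close>.
\<close>

definition order_ge :: "nat \<Rightarrow> int fps poly \<Rightarrow> bool" where
  "order_ge M f \<longleftrightarrow> (\<forall>i j. i + j < M \<longrightarrow> fps_nth (coeff f j) i = 0)"

lemma order_ge_mult:
  assumes "order_ge M f" "order_ge M' g"
  shows "order_ge (M + M') (f * g)"
  unfolding order_ge_def
proof (intro allI impI)
  fix i j :: nat
  assume ij: "i + j < M + M'"
  have "fps_nth (coeff f a) b * fps_nth (coeff g (j - a)) (i - b) = 0" if "a \<le> j" "b \<le> i" for a b
  proof (cases "a + b < M")
    case True
    then show ?thesis using assms(1) by (simp add: order_ge_def add.commute)
  next
    case False
    then have "(i - b) + (j - a) < M'" using that ij by linarith
    then show ?thesis using assms(2) by (simp add: order_ge_def)
  qed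
  then show "fps_nth (coeff (f * g) j) i = 0"
    unfolding coeff_mult fps_sum_nth fps_mult_nth by (intro sum.neutral ballI) simp
qed

lemma order_ge_0: "order_ge 0 f"
  by (simp add: order_ge_def)

lemma dual_negligible_boundary:
  "dual_negligible p L (boundary [:1 - fps_X:] (Suc L) (dual_point (1 - fps_X) k))"
proof -
  let ?z = "dual_point (1 - fps_X :: int fps) k" and ?X = "[:1 - fps_X :: int fps:]"
  have factor: "order_ge 1 (1 - ?z * ?X ^ i)" for i
    by (auto simp: order_ge_def dual_point_def poly_const_pow fps_power_zeroth)
  have prod: "order_ge M (\<Prod>i=1..M. 1 - ?z * ?X ^ i)" for M
  proof (induction M)
    case (Suc M)
    have "(\<Prod>i=1..Suc M. 1 - ?z * ?X ^ i) = (\<Prod>i=1..M. 1 - ?z * ?X ^ i) * (1 - ?z * ?X ^ Suc M)"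
      by (subst prod.cl_ivl_Suc) simp
    then show ?case
      using order_ge_mult[OF Suc.IH factor[of "Suc M"]] unfolding Suc_eq_plus1 by (simp only:)
  qed (rule order_ge_0)
  have "order_ge (Suc L) (boundary ?X (Suc L) ?z)"
    using order_ge_mult[OF order_ge_mult[OF order_ge_0 prod] order_ge_0]
    unfolding boundary_def by (simp only: add_0 add_0_right)
  then show ?thesis
    by (simp add: order_ge_def dual_negligible_def negligible_def)
qed

lemma negligible_one_minus_fps_X_power:
  assumes p: "prime p" "odd p" and "L \<le> p ^ a"
  shows "negligible p L ((1 - fps_X) ^ (p ^ a) - 1)"
proof -
  have "negligible p L (((1 - fps_X) ^ (p ^ a) - (1 - fps_X ^ (p ^ a))) - fps_X ^ (p ^ a))"
  proof (rule negligible_diff)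
    show "negligible p L ((1 - fps_X) ^ (p ^ a) - (1 - fps_X ^ (p ^ a)))"
      unfolding negligible_def using dvd_fps_nth[OF one_minus_fps_X_prime_power[OF p]] by blast
    show "negligible p L (fps_X ^ (p ^ a))"
      using assms(3) by (simp add: negligible_def)
  qed
  then show ?thesis by simp
qed

section \<open>The finite strange identity and its consequences\<close>

text \<open>
  Let \<open>W k\<close> be the weight of \<open>S(z)\<close> at \<open>z = x^k (1 + e)\<close>. Iteration gives \<open>W 0 = P - W K\<close> up to
  negligible terms, where \<open>P\<close> is the sum over \<open>k\<close> in the statement. Since \<open>x^K\<close> is congruent
  to \<open>1\<close>, \<open>W K\<close> can be computed at \<open>z = 1 + e\<close> instead; it then agrees with \<open>W 0 = - 2 F\<close>, although the weights of levels \<open>0\<close> and \<open>K\<close>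
  differ, because \<open>S(1) = 0\<close>.
\<close>

lemma fishburn_sum_eq_pentagonal_sum:
  assumes p: "prime p" "odd p" and L: "L \<le> p ^ a"
  defines "x \<equiv> 1 - fps_X :: int fps"
  shows "negligible p L (4 * (\<Sum>n\<le>L. \<Prod>i=1..n. 1 - x ^ i) +
    (\<Sum>k<p ^ a. (-1) ^ k * x ^ pentagonal k *
      (of_nat (6 * k + 1) - of_nat (6 * k + 5) * x ^ (2 * k + 1))))"
proof -
  define K where "K = p ^ a"
  have K: "odd K" using p by (simp add: K_def)
  define F where "F = (\<Sum>n\<le>L. \<Prod>i=1..n. 1 - x ^ i)"
  define P where "P = (\<Sum>k<K. (-1) ^ k * x ^ pentagonal k *
      (of_nat (6 * k + 1) - of_nat (6 * k + 5) * x ^ (2 * k + 1)))"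
  define B where "B = (\<lambda>k. level_weight k (boundary [:x:] (Suc L) (dual_point x k)))"
  define W where "W = (\<lambda>k. level_weight k (kz_sum [:x:] (Suc L) (dual_point x k)))"
  have xK: "negligible p L (x ^ K - 1)"
    unfolding x_def K_def by (rule negligible_one_minus_fps_X_power[OF p L])
  \<comment> \<open>\<open>3 K + 1\<close> is even, so \<open>K\<close> itself divides the exponent.\<close>
  have pentagonal_K: "pentagonal K = K * ((3 * K + 1) div 2)"
    using K unfolding pentagonal_def by (intro div_mult_swap[symmetric]) simp
  have "(x ^ K) - 1 dvd (x ^ K) ^ ((3 * K + 1) div 2) - 1 ^ ((3 * K + 1) div 2)"
    by (rule dvd_diff_power) simp
  then have x_pentagonal: "negligible p L (x ^ pentagonal K - 1)"
    unfolding pentagonal_K power_mult using xK by (auto elim!: dvdE intro: negligible_mult simp: mult.commute)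
  have zK: "dual_negligible p L (dual_point x K - [:1, 1:])"
    using xK by (simp add: dual_negligible_def dual_point_def)
  have W0: "W 0 = - 2 * F"
    using level_weight_kz_sum_0[of x "Suc L"]
    by (simp add: W_def dual_point_def F_def lessThan_Suc_atMost)
  have z0: "coeff (kz_sum [:x:] (Suc L) [:1, 1:]) 0 = 0"
    unfolding kz_sum_def coeff_sum coeff_mult_0
    by (intro sum.neutral ballI) (simp add: prod.atMost_shift coeff_mult_0)
  then have wt_indep: "level_weight k (kz_sum [:x:] (Suc L) [:1, 1:]) = - 2 * F" for k
    using W0 by (simp add: level_weight_def W_def dual_point_def)
  have WK: "negligible p L (W K + 2 * F)"
    using dual_negligible_level_weight[OF dual_negligible_kz_sum_diff[OF zK], of K "[:x:]" "Suc L"] wt_indep[of K]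
    by (simp add: W_def level_weight_diff)
  have B: "negligible p L (B k)" for k
    unfolding B_def x_def by (rule dual_negligible_level_weight[OF dual_negligible_boundary])
  have "W 0 = P - (\<Sum>k<K. (-1) ^ k * x ^ pentagonal k * B k) - x ^ pentagonal K * W K"
    using level_weight_kz_sum_iterate[of x "Suc L" K] K
    by (simp add: W_def P_def B_def sum_subtractf right_diff_distrib)
  then have "4 * F + P = (\<Sum>k<K. (-1) ^ k * x ^ pentagonal k * B k)
      + (x ^ pentagonal K * (W K + 2 * F) - 2 * F * (x ^ pentagonal K - 1))"
    using W0 by (simp add: algebra_simps)
  also have "negligible p L \<dots>"
    by (intro negligible_add negligible_diff negligible_sum negligible_mult B WK x_pentagonal)
  finally show ?thesis unfolding F_def P_def K_def .
qed

text \<open>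
  The hypothesis on \<open>j\<close> ignores the \<open>N\<close> with \<open>p dvd 24 N + 1\<close>: the corresponding terms carry a
  factor \<open>n\<close> divisible by \<open>p\<close>. For \<open>p = 23\<close> this is decisive, since those are the \<open>N\<close> with the
  largest residue \<open>22\<close>.
\<close>

theorem prime_dvd_fishburn:
  assumes p: "prime p" "odd p"
    and j: "\<And>n N. 24 * N + 1 = n\<^sup>2 \<Longrightarrow> \<not> p dvd n \<Longrightarrow> N mod p < j"
    and m: "j \<le> m mod p"
  shows "int p dvd fishburn m"
proof -
  let ?x = "1 - fps_X :: int fps"
  have key: "int p dvd fps_nth (of_nat n * ?x ^ N) m" if "24 * N + 1 = n\<^sup>2" for n N
  proof (cases "p dvd n")
    case True
    then show ?thesis by (intro dvd_fps_nth dvd_mult2 of_nat_dvd_of_natI)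
  next
    case False
    then show ?thesis
      using dvd_nth_one_minus_fps_X_power[OF p j[OF that] m] by (simp flip: fps_of_nat)
  qed
  have A: "int p dvd fps_nth (of_nat (6 * k + 1) * ?x ^ pentagonal k) m" for k
    by (rule key) (use two_pentagonal[of k] in \<open>simp add: power2_eq_square algebra_simps\<close>)
  have B: "int p dvd fps_nth (of_nat (6 * k + 5) * ?x ^ (pentagonal k + (2 * k + 1))) m" for k
    by (rule key) (use two_pentagonal[of k] in \<open>simp add: power2_eq_square algebra_simps\<close>)
  \<comment> \<open>Any exponent \<open>a\<close> with \<open>p^a > m\<close> would do.\<close>
  have "1 < p" using p(1) prime_gt_1_nat by blast
  then have L: "Suc m \<le> p ^ Suc m"
    using power_gt_expt[of p "Suc m"] by linarith
  let ?F = "\<Sum>n\<le>Suc m. \<Prod>i=1..n. 1 - ?x ^ i"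
  let ?t = "\<lambda>k. of_nat (6 * k + 1) * ?x ^ pentagonal k
    - of_nat (6 * k + 5) * ?x ^ (pentagonal k + (2 * k + 1))"
  let ?S = "\<Sum>k<p ^ Suc m. (-1) ^ k * ?t k"
  have "negligible p (Suc m) (4 * ?F + ?S)"
    using fishburn_sum_eq_pentagonal_sum[OF p L] by (simp add: algebra_simps power_add)
  then have "int p dvd fps_nth (4 * ?F) m + fps_nth ?S m"
    by (simp add: negligible_def)
  moreover have "int p dvd fps_nth ((-1) ^ k * ?t k) m" for k
    using A[of k] B[of k] by (cases "even k") (simp_all add: dvd_diff)
  then have "int p dvd fps_nth ?S m"
    unfolding fps_sum_nth by (intro dvd_sum) blast
  ultimately have "int p dvd fps_nth (4 * ?F) m"
    by (simp only: dvd_add_left_iff)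
  moreover have "fps_nth ?F m = fishburn m"
    unfolding fishburn_eq_sum sum.atMost_Suc fps_add_nth fps_sum_nth
    by (simp only: fishburn_summand_nth_eq_0[OF lessI] add_0_right)
  then have "fps_nth (4 * ?F) m = 4 * fishburn m"
    by (simp add: numeral_fps_const)
  moreover have "coprime (int p) 4"
  proof -
    have "coprime (int p) (2 ^ 2)" using p(2) by (intro coprime_power_right_iff[THEN iffD2]) simp
    then show ?thesis by simp
  qed
  ultimately show ?thesis
    by (simp add: coprime_dvd_mult_right_iff)
qed

theorem mainTheorem5:
  fixes n :: nat
  shows "[fishburn (23 * n + 18) = 0] (mod 23) \<and>
         [fishburn (23 * n + 19) = 0] (mod 23) \<and>
         [fishburn (23 * n + 20) = 0] (mod 23) \<and>
         [fishburn (23 * n + 21) = 0] (mod 23) \<and>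
         [fishburn (23 * n + 22) = 0] (mod 23)"
proof -
  have prime: "prime (23 :: nat)" by simp
  have residues: "N mod 23 < 18" if eq: "24 * N + 1 = k\<^sup>2" and k: "\<not> 23 dvd k" for k N :: nat
  proof -
    have "(N mod 23 + 1) mod 23 = (23 * N + (N + 1)) mod 23"
      by (simp only: mod_add_left_eq mod_mult_self4)
    also have "\<dots> = (k mod 23)\<^sup>2 mod 23" by (simp add: eq[symmetric] power_mod)
    finally have *: "(N mod 23 + 1) mod 23 = (k mod 23)\<^sup>2 mod 23" .
    have "k mod 23 \<in> set [1..<23]"
      using k by (auto simp: dvd_eq_mod_eq_0)
    moreover have "\<forall>r\<in>set [1..<23]. \<forall>c\<in>set [18..<23]. (c + 1) mod 23 \<noteq> r\<^sup>2 mod (23 :: nat)"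
      by code_simp
    ultimately have "N mod 23 \<notin> set [18..<23]" using * by blast
    moreover have "N mod 23 < 23" by simp
    ultimately show ?thesis unfolding set_upt atLeastLessThan_iff by linarith
  qed
  have "[fishburn (23 * n + i) = 0] (mod 23)" if "18 \<le> i" "i < 23" for i
    using prime_dvd_fishburn[where m = "23 * n + i", OF prime _ residues] that
    by (simp add: cong_0_iff)
  then show ?thesis by simp
qed

end
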